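(* Let $(G_n)_{n\in\mathbb{N}}$ be a sequence of dual surjunctive groups and let $\mathcal{U}$ be an ultrafilter on $\mathbb{N}$. Then the ultraproduct $\prod_{\mathcal{U}} G_n$ is dual surjunctive.
   Context: For a group $G$ and a finite set $A$, $A^G$ carries the product topology ($A$ discrete) and the action $(g\cdot f)(x)=f(g^{-1}x)$. A cellular automaton $T\colon A^G\to A^G$ is a continuous $G$-equivariant map. For $c,d\in A^G$ write $c\sim d$ if $\{g\in G: c(g)\neq d(g)\}$ is finite. $T$ is post-surjective if whenever $c,e\in A^G$ and $T(c)\sim e$, there is $c'\sim c$ with $T(c')=e$. $T$ is pre-injective if $c\sim d$ and $T(c)=T(d)$ imply $c=d$. A group $G$ is dual surjunctive if for every finite set $A$, every post-surjective cellular automaton $T\colon A^G\to A^G$ is pre-injective. $\prod_{\mathcal U}G_n$ is the (discrete) ultraproduct, i.e. the quotient of $\prod_n G_n$ identifying sequences that agree on a set in $\mathcal{U}$. *)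

theory Defs
  imports "HOL-Algebra.Product_Groups" "HOL-Analysis.Analysis"
begin

section \<open>Configurations and cellular automata\<close>

text \<open>
  A configuration over the alphabet \<open>A\<close> is an element of \<open>carrier G \<rightarrow>\<^sub>E A\<close>, i.e. a function with
  the fixed value \<open>undefined\<close> outside \<open>carrier G\<close>, so that equality of configurations is
  equality of HOL functions. This is the point set of the product topology below.
\<close>

definition config_topology ::
    "('g, 'm) monoid_scheme \<Rightarrow> 'b set \<Rightarrow> ('g \<Rightarrow> 'b) topology" where
  "config_topology G A = product_topology (\<lambda>_. discrete_topology A) (carrier G)"

definition shift ::
    "('g, 'm) monoid_scheme \<Rightarrow> 'g \<Rightarrow> ('g \<Rightarrow> 'b) \<Rightarrow> 'g \<Rightarrow> 'b" where
  "shift G g f = (\<lambda>x\<in>carrier G. f (inv\<^bsub>G\<^esub> g \<otimes>\<^bsub>G\<^esub> x))"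

text \<open>Only the values of \<open>T\<close> on configurations are constrained.\<close>

definition cellular_automaton ::
    "('g, 'm) monoid_scheme \<Rightarrow> 'b set \<Rightarrow> (('g \<Rightarrow> 'b) \<Rightarrow> ('g \<Rightarrow> 'b)) \<Rightarrow> bool" where
  "cellular_automaton G A T \<longleftrightarrow>
     continuous_map (config_topology G A) (config_topology G A) T \<and>
     (\<forall>g\<in>carrier G. \<forall>f\<in>carrier G \<rightarrow>\<^sub>E A. T (shift G g f) = shift G g (T f))"

definition asymptotic ::
    "('g, 'm) monoid_scheme \<Rightarrow> ('g \<Rightarrow> 'b) \<Rightarrow> ('g \<Rightarrow> 'b) \<Rightarrow> bool" where
  "asymptotic G c d \<longleftrightarrow> finite {g \<in> carrier G. c g \<noteq> d g}"

definition post_surjective ::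
    "('g, 'm) monoid_scheme \<Rightarrow> 'b set \<Rightarrow> (('g \<Rightarrow> 'b) \<Rightarrow> ('g \<Rightarrow> 'b)) \<Rightarrow> bool" where
  "post_surjective G A T \<longleftrightarrow>
     (\<forall>c\<in>carrier G \<rightarrow>\<^sub>E A. \<forall>e\<in>carrier G \<rightarrow>\<^sub>E A. asymptotic G (T c) e \<longrightarrow>
        (\<exists>c'\<in>carrier G \<rightarrow>\<^sub>E A. asymptotic G c' c \<and> T c' = e))"

definition pre_injective ::
    "('g, 'm) monoid_scheme \<Rightarrow> 'b set \<Rightarrow> (('g \<Rightarrow> 'b) \<Rightarrow> ('g \<Rightarrow> 'b)) \<Rightarrow> bool" where
  "pre_injective G A T \<longleftrightarrow>
     (\<forall>c\<in>carrier G \<rightarrow>\<^sub>E A. \<forall>d\<in>carrier G \<rightarrow>\<^sub>E A. asymptotic G c d \<longrightarrow> T c = T d \<longrightarrow> c = d)"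

text \<open>
  HOL cannot quantify over all types inside a formula, so the alphabets range over the finite sets
  of natural numbers. The lemma \<open>dual_surjunctive_any_alphabet\<close> below recovers the property for
  finite sets of elements of any type.
\<close>

definition dual_surjunctive :: "('g, 'm) monoid_scheme \<Rightarrow> bool" where
  "dual_surjunctive G \<longleftrightarrow> group G \<and>
     (\<forall>(A :: nat set) T. finite A \<longrightarrow> cellular_automaton G A T \<longrightarrow> post_surjective G A T \<longrightarrow>
        pre_injective G A T)"

lemma topspace_config_topology [simp]: "topspace (config_topology G A) = (carrier G \<rightarrow>\<^sub>E A)"
  by (simp add: config_topology_def)

lemma cellular_automaton_closed:
  assumes "cellular_automaton G A T" "f \<in> carrier G \<rightarrow>\<^sub>E A"
  shows "T f \<in> carrier G \<rightarrow>\<^sub>E A"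
  using assms continuous_map_funspace[of "config_topology G A" "config_topology G A" T]
  by (auto simp: cellular_automaton_def)

definition recode :: "('g, 'm) monoid_scheme \<Rightarrow> ('b \<Rightarrow> 'c) \<Rightarrow> ('g \<Rightarrow> 'b) \<Rightarrow> 'g \<Rightarrow> 'c" where
  "recode G h f = (\<lambda>x\<in>carrier G. h (f x))"

lemma recode_closed: "h ` A \<subseteq> B \<Longrightarrow> f \<in> carrier G \<rightarrow>\<^sub>E A \<Longrightarrow> recode G h f \<in> carrier G \<rightarrow>\<^sub>E B"
  by (auto simp: recode_def PiE_iff)

lemma recode_inverse:
  assumes "\<And>a. a \<in> A \<Longrightarrow> k (h a) = a" "f \<in> carrier G \<rightarrow>\<^sub>E A"
  shows "recode G k (recode G h f) = f"
  using assms by (auto simp: recode_def PiE_iff extensional_def fun_eq_iff)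

lemma recode_shift:
  assumes "group G" "g \<in> carrier G"
  shows "recode G h (shift G g f) = shift G g (recode G h f)"
proof -
  interpret group G by fact
  show ?thesis using assms by (auto simp: recode_def shift_def fun_eq_iff)
qed

lemma shift_closed:
  assumes "group G" "g \<in> carrier G" "f \<in> carrier G \<rightarrow>\<^sub>E A"
  shows "shift G g f \<in> carrier G \<rightarrow>\<^sub>E A"
proof -
  interpret group G by fact
  show ?thesis using assms by (auto simp: shift_def PiE_iff)
qed

lemma recode_continuous:
  assumes "h ` A \<subseteq> B"
  shows "continuous_map (config_topology G A) (config_topology G B) (recode G h)"
proof -
  have "continuous_map (config_topology G A) (discrete_topology B) (\<lambda>f. h (f x))"
    if "x \<in> carrier G" for x
  proof -
    have 1: "continuous_map (config_topology G A) (discrete_topology A) (\<lambda>f. f x)"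
      unfolding config_topology_def
      using continuous_map_product_projection[OF that, of "\<lambda>_. discrete_topology A"] by simp
    have 2: "continuous_map (discrete_topology A) (discrete_topology B) h"
      using assms by auto
    show ?thesis
      using continuous_map_compose[OF 1 2] by (simp add: o_def)
  qed
  then show ?thesis
    by (auto simp: recode_def config_topology_def continuous_map_componentwise)
qed

lemma asymptotic_recode: "asymptotic G c d \<Longrightarrow> asymptotic G (recode G h c) (recode G h d)"
  unfolding asymptotic_def by (erule rev_finite_subset) (auto simp: recode_def)

theorem dual_surjunctive_any_alphabet:
  fixes A :: "'b set"
  assumes G: "dual_surjunctive G" and A: "finite A"
    and T: "cellular_automaton G A T" and post: "post_surjective G A T"
  shows "pre_injective G A T"
proof -
  have grp: "group G" using G by (simp add: dual_surjunctive_def)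
  obtain h :: "'b \<Rightarrow> nat" where "bij_betw h A {0..<card A}"
    using ex_bij_betw_finite_nat[OF A] by blast
  define B where "B = {0..<card A}"
  define k where "k = inv_into A h"
  have h: "h ` A \<subseteq> B" and k: "k ` B \<subseteq> A"
    and kh: "\<And>a. a \<in> A \<Longrightarrow> k (h a) = a" and hk: "\<And>b. b \<in> B \<Longrightarrow> h (k b) = b"
    using \<open>bij_betw h A _\<close> unfolding B_def k_def
    by (auto simp: bij_betw_def inv_into_into f_inv_into_f)
  define S where "S = (\<lambda>f. recode G h (T (recode G k f)))"
  note hc = recode_closed[OF h, of _ G] and kc = recode_closed[OF k, of _ G]
  note Tc = cellular_automaton_closed[OF T]
  note khr = recode_inverse[where h=h and k=k and G=G and A=A, OF kh]
    and hkr = recode_inverse[where h=k and k=h and G=G and A=B, OF hk]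
  have "continuous_map (config_topology G B) (config_topology G B) S"
  proof -
    have "continuous_map (config_topology G A) (config_topology G A) T"
      using T by (simp add: cellular_automaton_def)
    from continuous_map_compose[OF continuous_map_compose[OF recode_continuous[OF k] this]
        recode_continuous[OF h]]
    show ?thesis by (simp add: S_def o_def)
  qed
  moreover have "S (shift G g f) = shift G g (S f)"
    if "g \<in> carrier G" "f \<in> carrier G \<rightarrow>\<^sub>E B" for g f
    using that T kc by (simp add: S_def recode_shift[OF grp] cellular_automaton_def)
  ultimately have 1: "cellular_automaton G B S"
    by (auto simp: cellular_automaton_def)
  have 2: "post_surjective G B S"
    unfolding post_surjective_def
  proof (intro ballI impI)
    fix c e assume c: "c \<in> carrier G \<rightarrow>\<^sub>E B" and e: "e \<in> carrier G \<rightarrow>\<^sub>E B"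
      and "asymptotic G (S c) e"
    then have "asymptotic G (recode G k (S c)) (recode G k e)"
      by (intro asymptotic_recode)
    then have "asymptotic G (T (recode G k c)) (recode G k e)"
      using c by (simp add: S_def khr Tc kc)
    then obtain c' where c': "c' \<in> carrier G \<rightarrow>\<^sub>E A" "asymptotic G c' (recode G k c)"
        "T c' = recode G k e"
      using post c e kc unfolding post_surjective_def by metis
    have "asymptotic G (recode G h c') c"
      using asymptotic_recode[OF c'(2), of h] c by (simp add: hkr)
    moreover have "S (recode G h c') = e"
      using c' e by (simp add: S_def khr hkr)
    ultimately show "\<exists>c'\<in>carrier G \<rightarrow>\<^sub>E B. asymptotic G c' c \<and> S c' = e"
      using hc c' by blast
  qed
  have "finite B" by (simp add: B_def)
  with G 1 2 have inj: "pre_injective G B S"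
    by (auto simp: dual_surjunctive_def)
  show ?thesis
    unfolding pre_injective_def
  proof (intro ballI impI)
    fix c d assume c: "c \<in> carrier G \<rightarrow>\<^sub>E A" and d: "d \<in> carrier G \<rightarrow>\<^sub>E A"
      and "asymptotic G c d" "T c = T d"
    then have "recode G h c = recode G h d"
      using inj hc asymptotic_recode[of G c d h] unfolding pre_injective_def
      by (simp add: S_def khr)
    then show "c = d" by (metis c d khr)
  qed
qed


section \<open>Ultraproducts of groups\<close>

text \<open>
  \<open>eventually P U\<close> says that the set \<open>{i. P i}\<close> belongs to the filter \<open>U\<close>.
  Principal ultrafilters are included.
\<close>

definition ultrafilter :: "'i filter \<Rightarrow> bool" where
  "ultrafilter U \<longleftrightarrow> U \<noteq> bot \<and> (\<forall>P. eventually P U \<or> eventually (\<lambda>i. \<not> P i) U)"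

definition ultraproduct_rel ::
    "'i filter \<Rightarrow> ('i \<Rightarrow> ('g, 'm) monoid_scheme) \<Rightarrow> (('i \<Rightarrow> 'g) \<times> ('i \<Rightarrow> 'g)) set" where
  "ultraproduct_rel U G =
     {(x, y). x \<in> carrier (product_group UNIV G) \<and> y \<in> carrier (product_group UNIV G) \<and>
              eventually (\<lambda>i. x i = y i) U}"

text \<open>
  The product of two classes is the class of \<open>x \<otimes> y\<close> for any representatives \<open>x\<close>, \<open>y\<close>; the
  union is over equal sets.
\<close>

definition ultraproduct ::
    "'i filter \<Rightarrow> ('i \<Rightarrow> ('g, 'm) monoid_scheme) \<Rightarrow> ('i \<Rightarrow> 'g) set monoid" where
  "ultraproduct U G =
     \<lparr>carrier = carrier (product_group UNIV G) // ultraproduct_rel U G,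
      monoid.mult = (\<lambda>X Y. \<Union>x\<in>X. \<Union>y\<in>Y. ultraproduct_rel U G `` {x \<otimes>\<^bsub>product_group UNIV G\<^esub> y}),
      one = ultraproduct_rel U G `` {\<one>\<^bsub>product_group UNIV G\<^esub>}\<rparr>"

lemma equiv_ultraproduct_rel:
  "equiv (carrier (product_group UNIV G)) (ultraproduct_rel U G)"
proof (rule equivI)
  show "ultraproduct_rel U G
      \<subseteq> carrier (product_group UNIV G) \<times> carrier (product_group UNIV G)"
    by (auto simp: ultraproduct_rel_def)
  show "refl_on (carrier (product_group UNIV G)) (ultraproduct_rel U G)"
    by (auto simp: ultraproduct_rel_def refl_on_def)
  show "sym (ultraproduct_rel U G)"
    by (auto simp: ultraproduct_rel_def sym_def eq_commute)
  show "trans (ultraproduct_rel U G)"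
    by (auto simp: ultraproduct_rel_def trans_def elim: eventually_elim2)
qed

lemma congruent2_ultraproduct_mult:
  assumes "\<And>i. group (G i)"
  shows "congruent2 (ultraproduct_rel U G) (ultraproduct_rel U G)
     (\<lambda>x y. ultraproduct_rel U G `` {x \<otimes>\<^bsub>product_group UNIV G\<^esub> y})"
proof (rule congruent2I')
  fix x x' y y'
  assume "(x, x') \<in> ultraproduct_rel U G" "(y, y') \<in> ultraproduct_rel U G"
  moreover have "group (product_group UNIV G)" by (simp add: assms)
  ultimately have "(x \<otimes>\<^bsub>product_group UNIV G\<^esub> y, x' \<otimes>\<^bsub>product_group UNIV G\<^esub> y') \<in> ultraproduct_rel U G"
    using monoid.m_closed[OF group.is_monoid[OF assms]]
    by (auto simp: ultraproduct_rel_def PiE_iff elim: eventually_elim2)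
  then show "ultraproduct_rel U G `` {x \<otimes>\<^bsub>product_group UNIV G\<^esub> y} =
      ultraproduct_rel U G `` {x' \<otimes>\<^bsub>product_group UNIV G\<^esub> y'}"
    using equiv_class_eq[OF equiv_ultraproduct_rel] by blast
qed

lemma ultraproduct_mult_class:
  assumes "\<And>i. group (G i)"
    and "x \<in> carrier (product_group UNIV G)" "y \<in> carrier (product_group UNIV G)"
  shows "(ultraproduct_rel U G `` {x}) \<otimes>\<^bsub>ultraproduct U G\<^esub> (ultraproduct_rel U G `` {y}) =
     ultraproduct_rel U G `` {x \<otimes>\<^bsub>product_group UNIV G\<^esub> y}"
  using UN_equiv_class2[OF equiv_ultraproduct_rel equiv_ultraproduct_rel
      congruent2_ultraproduct_mult[OF assms(1)] assms(2,3)]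
  by (simp add: ultraproduct_def)

lemma group_ultraproduct:
  assumes "\<And>i. group (G i)"
  shows "group (ultraproduct U G)"
proof -
  let ?P = "product_group UNIV G" and ?c = "\<lambda>x. ultraproduct_rel U G `` {x}"
  interpret P: group ?P by (simp add: assms)
  have one: "\<one>\<^bsub>ultraproduct U G\<^esub> = ?c \<one>\<^bsub>?P\<^esub>" by (simp add: ultraproduct_def)
  have car: "carrier (ultraproduct U G) = ?c ` carrier ?P"
    by (auto simp: ultraproduct_def quotient_def)
  note m = ultraproduct_mult_class[OF assms, where U=U]
  show ?thesis
  proof (rule groupI)
    fix X Y assume "X \<in> carrier (ultraproduct U G)" "Y \<in> carrier (ultraproduct U G)"
    then obtain x y where xy: "x \<in> carrier ?P" "y \<in> carrier ?P" "X = ?c x" "Y = ?c y"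
      unfolding car by blast
    have "?c (x \<otimes>\<^bsub>?P\<^esub> y) \<in> ?c ` carrier ?P"
      by (rule imageI) (rule P.m_closed[OF xy(1,2)])
    then show "X \<otimes>\<^bsub>ultraproduct U G\<^esub> Y \<in> carrier (ultraproduct U G)"
      unfolding car xy(3,4) m[OF xy(1,2)] .
  next
    show "\<one>\<^bsub>ultraproduct U G\<^esub> \<in> carrier (ultraproduct U G)"
      unfolding car one using P.one_closed by blast
  next
    fix X Y Z assume "X \<in> carrier (ultraproduct U G)" "Y \<in> carrier (ultraproduct U G)"
      "Z \<in> carrier (ultraproduct U G)"
    then obtain x y z where xyz: "x \<in> carrier ?P" "y \<in> carrier ?P" "z \<in> carrier ?P"
      and XYZ: "X = ?c x" "Y = ?c y" "Z = ?c z" unfolding car by blast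
    show "X \<otimes>\<^bsub>ultraproduct U G\<^esub> Y \<otimes>\<^bsub>ultraproduct U G\<^esub> Z =
        X \<otimes>\<^bsub>ultraproduct U G\<^esub> (Y \<otimes>\<^bsub>ultraproduct U G\<^esub> Z)"
      unfolding XYZ m[OF xyz(1,2)] m[OF xyz(2,3)] m[OF P.m_closed[OF xyz(1,2)] xyz(3)]
        m[OF xyz(1) P.m_closed[OF xyz(2,3)]] P.m_assoc[OF xyz] ..
  next
    fix X assume "X \<in> carrier (ultraproduct U G)"
    then obtain x where x: "x \<in> carrier ?P" "X = ?c x" unfolding car by blast
    show "\<one>\<^bsub>ultraproduct U G\<^esub> \<otimes>\<^bsub>ultraproduct U G\<^esub> X = X"
      unfolding one x(2) m[OF P.one_closed x(1)] P.l_one[OF x(1)] ..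
    show "\<exists>Y\<in>carrier (ultraproduct U G). Y \<otimes>\<^bsub>ultraproduct U G\<^esub> X = \<one>\<^bsub>ultraproduct U G\<^esub>"
      unfolding car
    proof (rule bexI)
      have i: "inv\<^bsub>?P\<^esub> x \<in> carrier ?P" by (rule P.inv_closed[OF x(1)])
      show "?c (inv\<^bsub>?P\<^esub> x) \<otimes>\<^bsub>ultraproduct U G\<^esub> X = \<one>\<^bsub>ultraproduct U G\<^esub>"
        unfolding one x(2) m[OF i x(1)] P.l_inv[OF x(1)] ..
      show "?c (inv\<^bsub>?P\<^esub> x) \<in> ?c ` carrier ?P" by (rule imageI[OF i])
    qed
  qed
qed

end

theory Submission
  imports Defs
begin

text \<open>
  Post-surjectivity and the failure of pre-injectivity are both finite phenomena, and a finite part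
  of an ultraproduct can be found inside almost all of its factors. So a counterexample over the
  ultraproduct would already give one over some factor.

  A cellular automaton \<open>T\<close> over \<open>G\<close> is given by a finite memory set \<open>S\<close> and a local rule, by
  compactness of \<open>A\<^sup>G\<close> (\<open>memory_set_exists\<close>). The definition of post-surjectivity puts no bound on the
  region where the preimage has to be modified, but a second compactness argument gives a bound
  (\<open>post_surjective_uniform\<close>): there is one finite \<open>N\<close> such that for each configuration \<open>d\<close> and
  each letter \<open>a\<close>, the value \<open>T d \<one>\<close> can be changed to \<open>a\<close>, and no other value of \<open>T d\<close>
  changed, by modifying \<open>d\<close> inside \<open>N\<close> only. Modifying \<open>d\<close> inside \<open>N\<close> influences \<open>T d\<close> only on
  \<open>N S\<inverse>\<close>, and the values there are determined by \<open>d\<close> on \<open>N S\<inverse> S\<close>; so this uniform condition is a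
  statement about the finite set \<open>N S\<inverse> S\<close>. Conversely, being able to change a single value
  implies post-surjectivity, by correcting finitely many values one after the other
  (\<open>post_surjective_if_one_site\<close>).

  Let \<open>\<phi>\<close> map \<open>G\<close> to a group \<open>H\<close> and be injective and multiplicative on a large enough
  finite set. The local rule of \<open>T\<close> with memory \<open>\<phi> ` S\<close> is a cellular automaton over \<open>H\<close>, and it
  behaves on \<open>h \<cdot> \<phi>(E)\<close> as \<open>T\<close> behaves on \<open>E\<close>. It inherits post-surjectivity from the uniform
  condition (\<open>post_surjective_transplant\<close>). If \<open>H\<close> is dual surjunctive, it is therefore
  pre-injective. Two asymptotic configurations over \<open>G\<close> with the same image under \<open>T\<close> can be
  copied to \<open>H\<close> around their finite set of differences, and so they are equal
  (\<open>pre_injective_transplant_imp\<close>). Hence a group which embeds locally into dual surjunctive groups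
  is dual surjunctive (\<open>dual_surjunctive_if_locally_embeddable\<close>). For an ultraproduct, the
  \<open>i\<close>-th coordinates of chosen representatives form such a local embedding for almost all \<open>i\<close>
  (\<open>local_embedding_ultraproduct\<close>).
\<close>

section \<open>Compactness of the space of configurations\<close>

lemma openin_cylinder:
  assumes "K \<subseteq> carrier G" "finite K" "c \<in> carrier G \<rightarrow>\<^sub>E A"
  shows "openin (config_topology G A) {d \<in> carrier G \<rightarrow>\<^sub>E A. \<forall>x\<in>K. d x = c x}"
proof -
  have "{d \<in> carrier G \<rightarrow>\<^sub>E A. \<forall>x\<in>K. d x = c x}
      = (\<Pi>\<^sub>E x\<in>carrier G. if x \<in> K then {c x} else A)"
    using assms by (auto simp: PiE_iff extensional_def split: if_splits)
  moreover have "openin (config_topology G A) (\<Pi>\<^sub>E x\<in>carrier G. if x \<in> K then {c x} else A)"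
    unfolding config_topology_def
  proof (rule openin_PiE_gen[THEN iffD2], intro disjI2 conjI ballI)
    show "finite {i \<in> carrier G. (if i \<in> K then {c i} else A) \<noteq> topspace (discrete_topology A)}"
      by (rule finite_subset[OF _ assms(2)]) auto
  qed (use assms in auto)
  ultimately show ?thesis by simp
qed

text \<open>
  The form in which compactness is used. A property \<open>Q F d\<close>, monotone in the finite set \<open>F\<close>, is
  supposed to hold near each configuration \<open>c\<close> for some \<open>F\<close>; finitely many of the neighbourhoods
  cover \<open>A\<^sup>G\<close>, and the union of their sets \<open>F\<close> serves for all \<open>d\<close>. Since \<open>carrier G\<close> may be
  uncountable, sequences would not suffice here; Tychonoff's theorem is needed.
\<close>
lemma uniform_finite_set:
  fixes G :: "('g, 'm) monoid_scheme" and A :: "'b set"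
  assumes A: "finite A"
    and mono: "\<And>F F' d. Q F d \<Longrightarrow> F \<subseteq> F' \<Longrightarrow> Q F' d"
    and loc: "\<And>c. c \<in> carrier G \<rightarrow>\<^sub>E A \<Longrightarrow> \<exists>F K. finite F \<and> F \<subseteq> carrier G \<and> finite K \<and> K \<subseteq> carrier G \<and>
        (\<forall>d\<in>carrier G \<rightarrow>\<^sub>E A. (\<forall>x\<in>K. d x = c x) \<longrightarrow> Q F d)"
  shows "\<exists>F. finite F \<and> F \<subseteq> carrier G \<and> (\<forall>d\<in>carrier G \<rightarrow>\<^sub>E A. Q F d)"
proof -
  define X where "X = (carrier G \<rightarrow>\<^sub>E A)"
  obtain F K where FK: "\<And>c. c \<in> X \<Longrightarrow> finite (F c) \<and> F c \<subseteq> carrier G \<and> finite (K c) \<and>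
      K c \<subseteq> carrier G \<and> (\<forall>d\<in>X. (\<forall>x\<in>K c. d x = c x) \<longrightarrow> Q (F c) d)"
    using loc unfolding X_def by metis
  define V where "V c = {d \<in> X. \<forall>x\<in>K c. d x = c x}" for c
  have "compact_space (config_topology G A)"
    unfolding config_topology_def
    by (simp add: compact_space_product_topology compact_space_discrete_topology A)
  moreover have "\<forall>W\<in>V ` X. openin (config_topology G A) W"
  proof
    fix W assume "W \<in> V ` X"
    then obtain c where c: "c \<in> X" "W = V c" by blast
    have "openin (config_topology G A) (V c)"
      unfolding V_def X_def by (rule openin_cylinder) (use FK[OF c(1)] c(1) X_def in auto)
    then show "openin (config_topology G A) W" using c(2) by simp
  qed
  moreover have "topspace (config_topology G A) \<subseteq> \<Union>(V ` X)"
    by (auto simp: V_def X_def)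
  ultimately have "\<exists>\<W>. finite \<W> \<and> \<W> \<subseteq> V ` X \<and> topspace (config_topology G A) \<subseteq> \<Union>\<W>"
    unfolding compact_space_alt by simp
  then obtain \<W> where W: "finite \<W>" "\<W> \<subseteq> V ` X" "X \<subseteq> \<Union>\<W>"
    by (auto simp: X_def)
  then obtain C where C: "finite C" "C \<subseteq> X" "\<W> = V ` C"
    by (meson finite_subset_image)
  have "Q (\<Union>(F ` C)) d" if "d \<in> X" for d
  proof -
    obtain c where c: "c \<in> C" "d \<in> V c" using W(3) C(3) \<open>d \<in> X\<close> by blast
    then have "c \<in> X" using C(2) by blast
    then have "Q (F c) d" using FK[of c] c(2) by (simp add: V_def)
    then show ?thesis by (rule mono) (use c(1) in auto)
  qed
  moreover have "F c \<subseteq> carrier G" "finite (F c)" if "c \<in> C" for c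
    using that C(2) FK[of c] by auto
  ultimately show ?thesis using C(1) unfolding X_def
    by (intro exI[of _ "\<Union>(F ` C)"]) auto
qed

section \<open>Memory sets\<close>

text \<open>
  By equivariance the value at \<open>\<one>\<close> determines \<open>T\<close>. The neutral element is put into \<open>S\<close> so that
  \<open>N \<subseteq> N S\<inverse> \<subseteq> N S\<inverse> S\<close> below.
\<close>
definition memory_set ::
    "('g, 'm) monoid_scheme \<Rightarrow> 'b set \<Rightarrow> (('g \<Rightarrow> 'b) \<Rightarrow> 'g \<Rightarrow> 'b) \<Rightarrow> 'g set \<Rightarrow> bool" where
  "memory_set G A T S \<longleftrightarrow> finite S \<and> S \<subseteq> carrier G \<and> \<one>\<^bsub>G\<^esub> \<in> S \<and>
     (\<forall>c\<in>carrier G \<rightarrow>\<^sub>E A. \<forall>d\<in>carrier G \<rightarrow>\<^sub>E A. (\<forall>s\<in>S. c s = d s) \<longrightarrow> T c \<one>\<^bsub>G\<^esub> = T d \<one>\<^bsub>G\<^esub>)"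

text \<open>
  The Curtis--Hedlund--Lyndon theorem: \<open>c \<mapsto> T c \<one>\<close> is continuous with values in a discrete space,
  hence locally constant, and compactness makes the finite set of relevant coordinates uniform.
\<close>
lemma memory_set_exists:
  assumes "group G" "finite A" and T: "cellular_automaton G A T"
  shows "\<exists>S. memory_set G A T S"
proof -
  interpret group G by fact
  let ?X = "carrier G \<rightarrow>\<^sub>E A"
  have cont: "continuous_map (config_topology G A) (discrete_topology A) (\<lambda>c. T c \<one>\<^bsub>G\<^esub>)"
    using T unfolding cellular_automaton_def
    by (metis config_topology_def continuous_map_componentwise one_closed)
  define Q where "Q F d \<longleftrightarrow> (\<forall>d'\<in>?X. (\<forall>x\<in>F. d' x = d x) \<longrightarrow> T d' \<one>\<^bsub>G\<^esub> = T d \<one>\<^bsub>G\<^esub>)" for F d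
  have "\<exists>F. finite F \<and> F \<subseteq> carrier G \<and> (\<forall>d\<in>?X. Q F d)"
  proof (rule uniform_finite_set[where Q=Q, OF \<open>finite A\<close>])
    show "Q F' d" if "Q F d" "F \<subseteq> F'" for F F' d
      using that unfolding Q_def by blast
    fix c assume c: "c \<in> ?X"
    have Tc: "T c \<one>\<^bsub>G\<^esub> \<in> A" using cellular_automaton_closed[OF T c] by auto
    have "openin (config_topology G A)
        {d \<in> topspace (config_topology G A). T d \<one>\<^bsub>G\<^esub> \<in> {T c \<one>\<^bsub>G\<^esub>}}"
      by (rule openin_continuous_map_preimage[OF cont]) (simp add: Tc)
    then have "openin (product_topology (\<lambda>_. discrete_topology A) (carrier G))
        {d \<in> ?X. T d \<one>\<^bsub>G\<^esub> = T c \<one>\<^bsub>G\<^esub>}"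
      by (simp add: config_topology_def)
    moreover have "c \<in> {d \<in> ?X. T d \<one>\<^bsub>G\<^esub> = T c \<one>\<^bsub>G\<^esub>}" using c by simp
    ultimately have "\<exists>W. finite {i \<in> carrier G. W i \<noteq> topspace (discrete_topology A)} \<and>
        (\<forall>i\<in>carrier G. openin (discrete_topology A) (W i)) \<and> c \<in> Pi\<^sub>E (carrier G) W \<and>
        Pi\<^sub>E (carrier G) W \<subseteq> {d \<in> ?X. T d \<one>\<^bsub>G\<^esub> = T c \<one>\<^bsub>G\<^esub>}"
      unfolding openin_product_topology_alt by (rule bspec)
    then obtain W where W: "finite {i \<in> carrier G. W i \<noteq> A}" "c \<in> Pi\<^sub>E (carrier G) W"
        "Pi\<^sub>E (carrier G) W \<subseteq> {d \<in> ?X. T d \<one>\<^bsub>G\<^esub> = T c \<one>\<^bsub>G\<^esub>}"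
      by (elim exE conjE) simp
    let ?K = "{i \<in> carrier G. W i \<noteq> A}"
    have K: "T d \<one>\<^bsub>G\<^esub> = T c \<one>\<^bsub>G\<^esub>" if "d \<in> ?X" "\<forall>x\<in>?K. d x = c x" for d
    proof -
      have "d x \<in> W x" if "x \<in> carrier G" for x
        using \<open>d \<in> ?X\<close> \<open>\<forall>x\<in>?K. d x = c x\<close> W(2) that by (cases "W x = A") (auto simp: PiE_iff)
      then have "d \<in> Pi\<^sub>E (carrier G) W" using \<open>d \<in> ?X\<close> by (auto simp: PiE_iff)
      then show ?thesis using W(3) by blast
    qed
    have "\<forall>d\<in>?X. (\<forall>x\<in>?K. d x = c x) \<longrightarrow> Q ?K d"
      unfolding Q_def
    proof (intro ballI impI)
      fix d d' assume d: "d \<in> ?X" "\<forall>x\<in>?K. d x = c x" and d': "d' \<in> ?X" "\<forall>x\<in>?K. d' x = d x"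
      show "T d' \<one>\<^bsub>G\<^esub> = T d \<one>\<^bsub>G\<^esub>" using K[OF d] K[OF d'(1)] d(2) d'(2) by simp
    qed
    then show "\<exists>F K. finite F \<and> F \<subseteq> carrier G \<and> finite K \<and> K \<subseteq> carrier G \<and>
        (\<forall>d\<in>?X. (\<forall>x\<in>K. d x = c x) \<longrightarrow> Q F d)"
      using W(1) by (intro exI[of _ ?K]) auto
  qed
  then obtain F where F: "finite F" "F \<subseteq> carrier G" "\<forall>d\<in>?X. Q F d" by blast
  have local: "T c \<one>\<^bsub>G\<^esub> = T d \<one>\<^bsub>G\<^esub>"
    if c: "c \<in> ?X" and d: "d \<in> ?X" and eq: "\<forall>s\<in>insert \<one>\<^bsub>G\<^esub> F. c s = d s" for c d
  proof (rule F(3)[unfolded Q_def, rule_format, OF d c])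
    show "c x = d x" if "x \<in> F" for x using eq that by blast
  qed
  have "finite (insert \<one>\<^bsub>G\<^esub> F)" "insert \<one>\<^bsub>G\<^esub> F \<subseteq> carrier G" "\<one>\<^bsub>G\<^esub> \<in> insert \<one>\<^bsub>G\<^esub> F"
    using F(1,2) by auto
  then have "memory_set G A T (insert \<one>\<^bsub>G\<^esub> F)"
    unfolding memory_set_def by (intro conjI ballI impI local) (assumption | erule (1) bspec)+
  then show ?thesis by blast
qed

lemma cellular_automaton_at:
  assumes "group G" "cellular_automaton G A T" "c \<in> carrier G \<rightarrow>\<^sub>E A" "g \<in> carrier G"
  shows "T c g = T (\<lambda>x\<in>carrier G. c (g \<otimes>\<^bsub>G\<^esub> x)) \<one>\<^bsub>G\<^esub>"
proof -
  interpret group G by fact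
  have "T (shift G (inv\<^bsub>G\<^esub> g) c) \<one>\<^bsub>G\<^esub> = shift G (inv\<^bsub>G\<^esub> g) (T c) \<one>\<^bsub>G\<^esub>"
    using assms by (simp add: cellular_automaton_def)
  then show ?thesis using assms(4) by (simp add: shift_def)
qed

lemma memory_set_local:
  assumes "group G" "cellular_automaton G A T" "memory_set G A T S"
    and "c \<in> carrier G \<rightarrow>\<^sub>E A" "d \<in> carrier G \<rightarrow>\<^sub>E A" "g \<in> carrier G"
    and "\<And>s. s \<in> S \<Longrightarrow> c (g \<otimes>\<^bsub>G\<^esub> s) = d (g \<otimes>\<^bsub>G\<^esub> s)"
  shows "T c g = T d g"
proof -
  interpret group G by fact
  let ?s = "\<lambda>f. \<lambda>x\<in>carrier G. f (g \<otimes>\<^bsub>G\<^esub> x)"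
  have closed: "?s f \<in> carrier G \<rightarrow>\<^sub>E A" if "f \<in> carrier G \<rightarrow>\<^sub>E A" for f
    using that assms(6) by auto
  have "\<forall>s\<in>S. ?s c s = ?s d s"
    using assms(3,7) by (auto simp: memory_set_def)
  then have "T (?s c) \<one>\<^bsub>G\<^esub> = T (?s d) \<one>\<^bsub>G\<^esub>"
    using assms(3) closed[OF assms(4)] closed[OF assms(5)] unfolding memory_set_def by blast
  then show ?thesis
    by (simp only: cellular_automaton_at[OF assms(1,2) assms(4,6)]
      cellular_automaton_at[OF assms(1,2) assms(5,6)])
qed

text \<open>
  The set \<open>N S\<inverse>\<close>: for a memory set \<open>S\<close>, the sites whose new value may change when a configuration
  is modified in \<open>N\<close>, because \<open>g S\<close> meets \<open>N\<close> iff \<open>g \<in> N S\<inverse>\<close>.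
\<close>
definition affected :: "('g, 'm) monoid_scheme \<Rightarrow> 'g set \<Rightarrow> 'g set \<Rightarrow> 'g set" where
  "affected G S N = (\<lambda>(x, s). x \<otimes>\<^bsub>G\<^esub> inv\<^bsub>G\<^esub> s) ` (N \<times> S)"

text \<open>The set \<open>N S\<inverse> S\<close>, on which the new values at the affected sites depend.\<close>
definition window :: "('g, 'm) monoid_scheme \<Rightarrow> 'g set \<Rightarrow> 'g set \<Rightarrow> 'g set" where
  "window G S N = (\<lambda>(g, s). g \<otimes>\<^bsub>G\<^esub> s) ` (affected G S N \<times> S)"

lemma affected_window:
  assumes "group G" "finite S" "S \<subseteq> carrier G" "\<one>\<^bsub>G\<^esub> \<in> S" "finite N" "N \<subseteq> carrier G"
  shows "finite (affected G S N)" "affected G S N \<subseteq> carrier G" "N \<subseteq> affected G S N"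
    "finite (window G S N)" "window G S N \<subseteq> carrier G" "affected G S N \<subseteq> window G S N"
proof -
  interpret group G by fact
  show fin: "finite (affected G S N)" and cl: "affected G S N \<subseteq> carrier G"
    using assms by (auto simp: affected_def intro!: m_closed inv_closed)
  show "finite (window G S N)" and "window G S N \<subseteq> carrier G"
    using assms fin cl by (auto simp: window_def intro!: m_closed)
  show "N \<subseteq> affected G S N"
  proof
    fix x assume "x \<in> N"
    then show "x \<in> affected G S N"
      using assms unfolding affected_def by (intro image_eqI[of _ _ "(x, \<one>\<^bsub>G\<^esub>)"]) auto
  qed
  show "affected G S N \<subseteq> window G S N"
  proof
    fix x assume "x \<in> affected G S N"
    then show "x \<in> window G S N"
      using assms cl unfolding window_def by (intro image_eqI[of _ _ "(x, \<one>\<^bsub>G\<^esub>)"]) auto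
  qed
qed

section \<open>Post-surjectivity as a one-site condition\<close>

text \<open>Induction on the finite set where \<open>T c\<close> differs from the target.\<close>
lemma post_surjective_if_one_site:
  assumes T: "cellular_automaton G A T"
    and site: "\<And>c h a. c \<in> carrier G \<rightarrow>\<^sub>E A \<Longrightarrow> h \<in> carrier G \<Longrightarrow> a \<in> A \<Longrightarrow>
      \<exists>c'\<in>carrier G \<rightarrow>\<^sub>E A. asymptotic G c' c \<and> T c' = (T c)(h := a)"
  shows "post_surjective G A T"
  unfolding post_surjective_def
proof (intro ballI impI)
  fix c e assume c: "c \<in> carrier G \<rightarrow>\<^sub>E A" and e: "e \<in> carrier G \<rightarrow>\<^sub>E A"
    and "asymptotic G (T c) e"
  define D where "D = {g \<in> carrier G. T c g \<noteq> e g}"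
  have "finite D" using \<open>asymptotic G (T c) e\<close> by (simp add: asymptotic_def D_def)
  then show "\<exists>c'\<in>carrier G \<rightarrow>\<^sub>E A. asymptotic G c' c \<and> T c' = e"
    using c D_def
  proof (induction D arbitrary: c rule: finite_induct)
    case empty
    have "T c = e"
      using empty cellular_automaton_closed[OF T] e
      by (intro PiE_ext[of _ "carrier G" "\<lambda>_. A"]) auto
    then show ?case using empty by (intro bexI[of _ c]) (auto simp: asymptotic_def)
  next
    case (insert h D)
    have h: "h \<in> carrier G" using insert by blast
    then obtain c1 where c1: "c1 \<in> carrier G \<rightarrow>\<^sub>E A" "asymptotic G c1 c"
        "T c1 = (T c)(h := e h)"
      using site[OF insert.prems(1) h, of "e h"] e by blast
    have "D = {g \<in> carrier G. T c1 g \<noteq> e g}"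
      using insert.hyps(2) insert.prems(2) unfolding c1(3) by (auto simp: fun_upd_def)
    then obtain c' where c': "c' \<in> carrier G \<rightarrow>\<^sub>E A" "asymptotic G c' c1" "T c' = e"
      using insert.IH c1(1) by blast
    have "{g \<in> carrier G. c' g \<noteq> c g}
        \<subseteq> {g \<in> carrier G. c' g \<noteq> c1 g} \<union> {g \<in> carrier G. c1 g \<noteq> c g}" by auto
    then have "asymptotic G c' c"
      using c'(2) c1(2) unfolding asymptotic_def by (meson finite_UnI finite_subset)
    then show ?case using c' by blast
  qed
qed

text \<open>
  Each configuration \<open>c\<close> has its own finite region \<open>N\<close> of modification, the union over the finitely
  many letters \<open>a\<close>. The same \<open>N\<close> works for every \<open>d\<close> that agrees with \<open>c\<close> on \<open>N S\<inverse> S\<close>: the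
  values chosen for \<open>c\<close> in \<open>N\<close> are put into \<open>d\<close>. So the property is open, and compactness applies.
\<close>
lemma post_surjective_uniform:
  assumes "group G" "finite A" and T: "cellular_automaton G A T" and post: "post_surjective G A T"
    and S: "memory_set G A T S"
  shows "\<exists>N. finite N \<and> N \<subseteq> carrier G \<and> \<one>\<^bsub>G\<^esub> \<in> N \<and>
    (\<forall>d\<in>carrier G \<rightarrow>\<^sub>E A. \<forall>a\<in>A. \<exists>d'\<in>carrier G \<rightarrow>\<^sub>E A.
       (\<forall>x\<in>carrier G - N. d' x = d x) \<and> T d' = (T d)(\<one>\<^bsub>G\<^esub> := a))"
proof -
  interpret group G by fact
  let ?X = "carrier G \<rightarrow>\<^sub>E A"
  have S': "finite S" "S \<subseteq> carrier G" "\<one>\<^bsub>G\<^esub> \<in> S" using S by (auto simp: memory_set_def)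
  note Tcl = cellular_automaton_closed[OF T]
  note loc = memory_set_local[OF \<open>group G\<close> T S]
  define Q where "Q N d \<longleftrightarrow> (\<forall>a\<in>A. \<exists>d'\<in>?X.
       (\<forall>x\<in>carrier G - N. d' x = d x) \<and> T d' = (T d)(\<one>\<^bsub>G\<^esub> := a))" for N d
  have mono: "Q F' d" if Q: "Q F d" and sub: "F \<subseteq> F'" for F F' d
    unfolding Q_def
  proof
    fix a assume "a \<in> A"
    then obtain d' where "d' \<in> ?X" "\<forall>x\<in>carrier G - F. d' x = d x" "T d' = (T d)(\<one>\<^bsub>G\<^esub> := a)"
      using Q[unfolded Q_def, rule_format, OF \<open>a \<in> A\<close>] by (elim bexE conjE)
    then show "\<exists>d'\<in>?X. (\<forall>x\<in>carrier G - F'. d' x = d x) \<and> T d' = (T d)(\<one>\<^bsub>G\<^esub> := a)"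
      using sub by (intro bexI[of _ d']) auto
  qed
  have "\<exists>F. finite F \<and> F \<subseteq> carrier G \<and> (\<forall>d\<in>?X. Q F d)"
  proof (rule uniform_finite_set[where Q=Q, OF \<open>finite A\<close>])
    show "Q F' d" if "Q F d" "F \<subseteq> F'" for F F' d using that by (rule mono)
    fix c assume c: "c \<in> ?X"
    have "\<exists>c'\<in>?X. asymptotic G c' c \<and> T c' = (T c)(\<one>\<^bsub>G\<^esub> := a)" if "a \<in> A" for a
    proof -
      have "(T c)(\<one>\<^bsub>G\<^esub> := a) \<in> ?X" using Tcl[OF c] that by (auto simp: PiE_iff extensional_def)
      moreover have "asymptotic G (T c) ((T c)(\<one>\<^bsub>G\<^esub> := a))"
        unfolding asymptotic_def by (rule finite_subset[of _ "{\<one>\<^bsub>G\<^esub>}"]) auto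
      ultimately show ?thesis
        using post[unfolded post_surjective_def, rule_format, OF c] by simp
    qed
    then have "\<forall>a\<in>A. \<exists>c'. c' \<in> ?X \<and> asymptotic G c' c \<and> T c' = (T c)(\<one>\<^bsub>G\<^esub> := a)"
      by (simp add: Bex_def)
    then obtain f where f: "\<And>a. a \<in> A \<Longrightarrow> f a \<in> ?X \<and> asymptotic G (f a) c \<and>
        T (f a) = (T c)(\<one>\<^bsub>G\<^esub> := a)"
      by (auto dest!: bchoice)
    \<comment> \<open>With \<open>\<one> \<in> N\<close> the site \<open>\<one>\<close> is affected. So \<open>T d\<close> and \<open>T c\<close> agree there, and no
      unaffected site has to be changed.\<close>
    define N where "N = insert \<one>\<^bsub>G\<^esub> (\<Union>a\<in>A. {x \<in> carrier G. f a x \<noteq> c x})"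
    have N: "finite N" "N \<subseteq> carrier G" "\<one>\<^bsub>G\<^esub> \<in> N"
      using f \<open>finite A\<close> by (auto simp: N_def asymptotic_def)
    note aw = affected_window[OF \<open>group G\<close> S' N(1,2)]
    have "Q N d" if d: "d \<in> ?X" "\<forall>x\<in>window G S N. d x = c x" for d
      unfolding Q_def
    proof
      fix a assume a: "a \<in> A"
      have fc: "f a x = c x" if "x \<in> carrier G" "x \<notin> N" for x
        using that a unfolding N_def by blast
      define d' where "d' = (\<lambda>x\<in>carrier G. if x \<in> N then f a x else d x)"
      have d': "d' \<in> ?X" using d(1) f[OF a] by (auto simp: d'_def)
      have "T d' g = ((T d)(\<one>\<^bsub>G\<^esub> := a)) g" if g: "g \<in> carrier G" for g
      proof (cases "g \<in> affected G S N")
        case True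
        then have w: "g \<otimes>\<^bsub>G\<^esub> s \<in> window G S N" if "s \<in> S" for s
          using that by (auto simp: window_def)
        have "T d' g = T (f a) g"
        proof (rule loc[OF d' _ g])
          fix s assume "s \<in> S"
          then have "g \<otimes>\<^bsub>G\<^esub> s \<in> window G S N" "g \<otimes>\<^bsub>G\<^esub> s \<in> carrier G" using w aw(5) by auto
          then show "d' (g \<otimes>\<^bsub>G\<^esub> s) = f a (g \<otimes>\<^bsub>G\<^esub> s)"
            using fc d(2) by (simp add: d'_def)
        qed (simp add: f[OF a])
        moreover have "T d g = T c g"
          by (rule loc[OF d(1) c g]) (simp add: d(2) w)
        ultimately show ?thesis by (simp add: f[OF a])
      next
        case False
        have nN: "g \<otimes>\<^bsub>G\<^esub> s \<notin> N" if "s \<in> S" for s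
        proof
          assume "g \<otimes>\<^bsub>G\<^esub> s \<in> N"
          moreover have "s \<in> carrier G" using that S' by blast
          ultimately have "g \<in> affected G S N" unfolding affected_def using g that
            by (intro image_eqI[of _ _ "(g \<otimes>\<^bsub>G\<^esub> s, s)"]) (auto simp: m_assoc)
          then show False using False by simp
        qed
        have "T d' g = T d g"
          using nN S'(2) g by (intro loc[OF d' d(1) g]) (auto simp: d'_def)
        moreover have "g \<noteq> \<one>\<^bsub>G\<^esub>" using False aw(3) N(3) by blast
        ultimately show ?thesis by simp
      qed
      then have "T d' = (T d)(\<one>\<^bsub>G\<^esub> := a)"
        using Tcl[OF d'] Tcl[OF d(1)] a
        by (intro PiE_ext[of _ "carrier G" "\<lambda>_. A"]) (auto simp: PiE_iff extensional_def)
      moreover have "\<forall>x\<in>carrier G - N. d' x = d x" by (simp add: d'_def)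
      ultimately show "\<exists>d'\<in>?X. (\<forall>x\<in>carrier G - N. d' x = d x) \<and> T d' = (T d)(\<one>\<^bsub>G\<^esub> := a)"
        by (intro bexI[OF _ d'] conjI)
    qed
    then show "\<exists>F K. finite F \<and> F \<subseteq> carrier G \<and> finite K \<and> K \<subseteq> carrier G \<and>
        (\<forall>d\<in>?X. (\<forall>x\<in>K. d x = c x) \<longrightarrow> Q F d)"
      using N aw(4,5) by (intro exI[of _ N] exI[of _ "window G S N"]) simp
  qed
  then obtain F where F: "finite F" "F \<subseteq> carrier G" "\<forall>d\<in>?X. Q F d" by blast
  define N where "N = insert \<one>\<^bsub>G\<^esub> F"
  have "\<forall>d\<in>?X. Q N d" unfolding N_def by (intro ballI mono[OF F(3)[rule_format]]) auto
  note Q = this[unfolded Q_def]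
  have N: "finite N" "N \<subseteq> carrier G" "\<one>\<^bsub>G\<^esub> \<in> N"
    using F(1,2) by (auto simp: N_def)
  show ?thesis
    by (rule exI[of _ N], intro conjI, rule N(1), rule N(2), rule N(3), rule Q)
qed

section \<open>Transplanting a cellular automaton along a local embedding\<close>

text \<open>
  The product \<open>x \<otimes> y\<close> need not belong to \<open>E\<close>, and outside \<open>E\<close> the map \<open>\<phi>\<close> may be arbitrary as
  long as its values are in \<open>H\<close>.
\<close>
definition local_embedding ::
    "('g, 'm) monoid_scheme \<Rightarrow> ('h, 'n) monoid_scheme \<Rightarrow> ('g \<Rightarrow> 'h) \<Rightarrow> 'g set \<Rightarrow> bool" where
  "local_embedding G H \<phi> E \<longleftrightarrow> \<phi> \<in> carrier G \<rightarrow> carrier H \<and> inj_on \<phi> E \<and>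
     (\<forall>x\<in>E. \<forall>y\<in>E. \<phi> (x \<otimes>\<^bsub>G\<^esub> y) = \<phi> x \<otimes>\<^bsub>H\<^esub> \<phi> y)"

locale transplantation =
  G: group G + H: group H
  for G :: "('g, 'm) monoid_scheme" (structure) and H :: "('h, 'n) monoid_scheme" (structure) +
  fixes A :: "'b set" and T :: "('g \<Rightarrow> 'b) \<Rightarrow> 'g \<Rightarrow> 'b" and S :: "'g set" and \<phi> :: "'g \<Rightarrow> 'h"
  assumes T: "cellular_automaton G A T"
    and S: "memory_set G A T S"
    and \<phi>: "\<phi> \<in> carrier G \<rightarrow> carrier H"
begin

text \<open>
  The configuration seen from the site \<open>h\<close> through \<open>\<phi>\<close>. The transplant applies the local rule of
  \<open>T\<close> to it; only the sites \<open>h \<otimes> \<phi> s\<close> with \<open>s \<in> S\<close> matter, so that pulling back all of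
  \<open>carrier G\<close> avoids choosing values outside the memory set.
\<close>
definition pull :: "'h \<Rightarrow> ('h \<Rightarrow> 'b) \<Rightarrow> 'g \<Rightarrow> 'b" where
  "pull h c = (\<lambda>x\<in>carrier G. c (h \<otimes>\<^bsub>H\<^esub> \<phi> x))"

definition transplant :: "('h \<Rightarrow> 'b) \<Rightarrow> 'h \<Rightarrow> 'b" where
  "transplant c = (\<lambda>h\<in>carrier H. T (pull h c) \<one>\<^bsub>G\<^esub>)"

lemma S_closed: "finite S" "S \<subseteq> carrier G" "\<one>\<^bsub>G\<^esub> \<in> S"
  using S by (auto simp: memory_set_def)

lemma \<phi>_closed: "x \<in> carrier G \<Longrightarrow> \<phi> x \<in> carrier H"
  using \<phi> by blast

lemma pull_closed:
  "h \<in> carrier H \<Longrightarrow> c \<in> carrier H \<rightarrow>\<^sub>E A \<Longrightarrow> pull h c \<in> carrier G \<rightarrow>\<^sub>E A"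
  by (auto simp: pull_def \<phi>_closed)

lemma transplant_closed:
  assumes "c \<in> carrier H \<rightarrow>\<^sub>E A" shows "transplant c \<in> carrier H \<rightarrow>\<^sub>E A"
  using PiE_mem[OF cellular_automaton_closed[OF T pull_closed[OF _ assms]] G.one_closed]
  by (auto simp: transplant_def)

lemmas T_local = memory_set_local[OF G.group_axioms T S]

lemma transplant_local:
  assumes "c \<in> carrier H \<rightarrow>\<^sub>E A" "d \<in> carrier H \<rightarrow>\<^sub>E A" "h \<in> carrier H"
    and "\<And>s. s \<in> S \<Longrightarrow> c (h \<otimes>\<^bsub>H\<^esub> \<phi> s) = d (h \<otimes>\<^bsub>H\<^esub> \<phi> s)"
  shows "transplant c h = transplant d h"
proof -
  have "T (pull h c) \<one>\<^bsub>G\<^esub> = T (pull h d) \<one>\<^bsub>G\<^esub>"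
    using assms S_closed by (intro T_local pull_closed) (auto simp: pull_def subset_iff)
  then show ?thesis using assms by (simp add: transplant_def)
qed

lemma cellular_automaton_transplant: "cellular_automaton H A transplant"
  unfolding cellular_automaton_def
proof (intro conjI ballI)
  have "continuous_map (config_topology H A) (discrete_topology A) (\<lambda>c. transplant c h)"
    if h: "h \<in> carrier H" for h
  proof -
    let ?K = "(\<lambda>s. h \<otimes>\<^bsub>H\<^esub> \<phi> s) ` S"
    have K: "?K \<subseteq> carrier H" "finite ?K" using h S_closed \<phi>_closed by auto
    have "openin (config_topology H A) {c \<in> carrier H \<rightarrow>\<^sub>E A. transplant c h \<in> W}" for W
    proof (subst openin_subopen, intro ballI)
      fix c assume "c \<in> {c \<in> carrier H \<rightarrow>\<^sub>E A. transplant c h \<in> W}"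
      then have c: "c \<in> carrier H \<rightarrow>\<^sub>E A" "transplant c h \<in> W" by auto
      let ?V = "{d \<in> carrier H \<rightarrow>\<^sub>E A. \<forall>x\<in>?K. d x = c x}"
      have "?V \<subseteq> {c \<in> carrier H \<rightarrow>\<^sub>E A. transplant c h \<in> W}"
        using transplant_local[OF _ c(1) h] c(2) by auto
      moreover have "c \<in> ?V" using c by simp
      ultimately show "\<exists>V. openin (config_topology H A) V \<and> c \<in> V \<and>
          V \<subseteq> {c \<in> carrier H \<rightarrow>\<^sub>E A. transplant c h \<in> W}"
        using openin_cylinder[OF K c(1)] by blast
    qed
    then show ?thesis
      using transplant_closed h by (auto simp: continuous_map_def)
  qed
  then show "continuous_map (config_topology H A) (config_topology H A) transplant"
    by (subst (2) config_topology_def)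
      (auto simp: continuous_map_componentwise transplant_def)
next
  fix g f assume g: "g \<in> carrier H" and f: "f \<in> carrier H \<rightarrow>\<^sub>E A"
  have "pull h (shift H g f) = pull (inv\<^bsub>H\<^esub> g \<otimes>\<^bsub>H\<^esub> h) f" if "h \<in> carrier H" for h
    using that g by (auto simp: pull_def shift_def H.m_assoc \<phi>_closed)
  then show "transplant (shift H g f) = shift H g (transplant f)"
    using g by (auto simp: transplant_def shift_def)
qed

text \<open>
  Where \<open>\<phi>\<close> is multiplicative, the pullback at \<open>h\<close> intertwines the transplant with \<open>T\<close>: the
  pullback at \<open>h \<otimes> \<phi> g\<close> agrees on \<open>S\<close> with the translate by \<open>g\<close> of the pullback at \<open>h\<close>.
\<close>
lemma transplant_at:
  assumes c: "c \<in> carrier H \<rightarrow>\<^sub>E A" and h: "h \<in> carrier H" and g: "g \<in> carrier G"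
    and mult: "\<And>s. s \<in> S \<Longrightarrow> \<phi> (g \<otimes>\<^bsub>G\<^esub> s) = \<phi> g \<otimes>\<^bsub>H\<^esub> \<phi> s"
  shows "transplant c (h \<otimes>\<^bsub>H\<^esub> \<phi> g) = T (pull h c) g"
proof -
  have hg: "h \<otimes>\<^bsub>H\<^esub> \<phi> g \<in> carrier H" using h g \<phi>_closed by simp
  have "T (pull (h \<otimes>\<^bsub>H\<^esub> \<phi> g) c) \<one>\<^bsub>G\<^esub> = T (\<lambda>x\<in>carrier G. pull h c (g \<otimes>\<^bsub>G\<^esub> x)) \<one>\<^bsub>G\<^esub>"
  proof (rule T_local)
    show "pull (h \<otimes>\<^bsub>H\<^esub> \<phi> g) c \<in> carrier G \<rightarrow>\<^sub>E A" by (rule pull_closed[OF hg c])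
    show "(\<lambda>x\<in>carrier G. pull h c (g \<otimes>\<^bsub>G\<^esub> x)) \<in> carrier G \<rightarrow>\<^sub>E A"
      using pull_closed[OF h c] g by auto
    fix s assume s: "s \<in> S"
    then have "s \<in> carrier G" using S_closed by blast
    then show "pull (h \<otimes>\<^bsub>H\<^esub> \<phi> g) c (\<one>\<^bsub>G\<^esub> \<otimes>\<^bsub>G\<^esub> s)
        = (\<lambda>x\<in>carrier G. pull h c (g \<otimes>\<^bsub>G\<^esub> x)) (\<one>\<^bsub>G\<^esub> \<otimes>\<^bsub>G\<^esub> s)"
      using g h mult[OF s] by (simp add: pull_def H.m_assoc \<phi>_closed)
  qed simp
  also have "\<dots> = T (pull h c) g"
    using cellular_automaton_at[OF G.group_axioms T pull_closed[OF h c] g] by simp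
  finally show ?thesis using hg by (simp add: transplant_def)
qed

text \<open>
  If \<open>k \<otimes> \<phi> s = h \<otimes> \<phi> x\<close> with \<open>x \<in> N\<close>, then \<open>k = h \<otimes> \<phi> (x \<otimes> inv s)\<close>: sites that are unaffected in
  \<open>G\<close> stay so in \<open>H\<close>, including those outside the range of \<open>\<phi>\<close>.
\<close>
lemma transplant_unaffected:
  assumes N: "N \<subseteq> carrier G"
    and E: "local_embedding G H \<phi> E" "affected G S N \<subseteq> E" "S \<subseteq> E"
    and c: "c \<in> carrier H \<rightarrow>\<^sub>E A" and d: "d \<in> carrier H \<rightarrow>\<^sub>E A"
    and h: "h \<in> carrier H" and k: "k \<in> carrier H"
    and diff: "\<And>y. y \<in> carrier H \<Longrightarrow> c y \<noteq> d y \<Longrightarrow> y \<in> (\<lambda>x. h \<otimes>\<^bsub>H\<^esub> \<phi> x) ` N"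
    and "k \<notin> (\<lambda>g. h \<otimes>\<^bsub>H\<^esub> \<phi> g) ` affected G S N"
  shows "transplant c k = transplant d k"
proof (rule transplant_local[OF c d k], rule ccontr)
  fix s assume s: "s \<in> S" and "c (k \<otimes>\<^bsub>H\<^esub> \<phi> s) \<noteq> d (k \<otimes>\<^bsub>H\<^esub> \<phi> s)"
  then have sG: "s \<in> carrier G" using S_closed by blast
  obtain x where x: "x \<in> N" "k \<otimes>\<^bsub>H\<^esub> \<phi> s = h \<otimes>\<^bsub>H\<^esub> \<phi> x"
    using diff[of "k \<otimes>\<^bsub>H\<^esub> \<phi> s"] k sG \<phi>_closed \<open>c _ \<noteq> d _\<close> by auto
  define g where "g = x \<otimes>\<^bsub>G\<^esub> inv\<^bsub>G\<^esub> s"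
  have xG: "x \<in> carrier G" and gG: "g \<in> carrier G" and ga: "g \<in> affected G S N"
    using x(1) N s sG by (auto simp: g_def affected_def)
  have "\<phi> x = \<phi> (g \<otimes>\<^bsub>G\<^esub> s)" using xG sG by (simp add: g_def G.m_assoc)
  also have "\<dots> = \<phi> g \<otimes>\<^bsub>H\<^esub> \<phi> s"
    using E ga s unfolding local_embedding_def by blast
  finally have "k \<otimes>\<^bsub>H\<^esub> \<phi> s = (h \<otimes>\<^bsub>H\<^esub> \<phi> g) \<otimes>\<^bsub>H\<^esub> \<phi> s"
    using x(2) h gG sG by (simp add: H.m_assoc \<phi>_closed)
  then have "k = h \<otimes>\<^bsub>H\<^esub> \<phi> g"
    using k h gG sG by (simp add: \<phi>_closed)
  then show False using assms(10) ga by blast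
qed

text \<open>
  To change the value at \<open>h\<close>, the pullback at \<open>h\<close> is modified in \<open>N\<close>, and the result is copied
  back to \<open>h \<cdot> \<phi>(N)\<close>. The affected sites are computed in \<open>G\<close>; the others keep their values.
\<close>
lemma post_surjective_transplant:
  assumes N: "finite N" "N \<subseteq> carrier G" "\<one>\<^bsub>G\<^esub> \<in> N"
    and site: "\<And>p a. p \<in> carrier G \<rightarrow>\<^sub>E A \<Longrightarrow> a \<in> A \<Longrightarrow> \<exists>p'\<in>carrier G \<rightarrow>\<^sub>E A.
       (\<forall>x\<in>carrier G - N. p' x = p x) \<and> T p' = (T p)(\<one>\<^bsub>G\<^esub> := a)"
    and E: "local_embedding G H \<phi> E" "window G S N \<subseteq> E" "S \<subseteq> E"
  shows "post_surjective H A transplant"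
proof (rule post_surjective_if_one_site[OF cellular_automaton_transplant])
  fix c h a assume c: "c \<in> carrier H \<rightarrow>\<^sub>E A" and h: "h \<in> carrier H" and a: "a \<in> A"
  note aw = affected_window[OF G.group_axioms S_closed N(1,2)]
  have inj: "x = y" if "\<phi> x = \<phi> y" "x \<in> window G S N" "y \<in> window G S N" for x y
    using that E unfolding local_embedding_def by (meson inj_onD subsetD)
  have mult: "\<phi> (g \<otimes>\<^bsub>G\<^esub> s) = \<phi> g \<otimes>\<^bsub>H\<^esub> \<phi> s" if "g \<in> affected G S N" "s \<in> S" for g s
    using that E aw(6) unfolding local_embedding_def by blast
  have "\<phi> (\<one>\<^bsub>G\<^esub> \<otimes>\<^bsub>G\<^esub> \<one>\<^bsub>G\<^esub>) = \<phi> \<one>\<^bsub>G\<^esub> \<otimes>\<^bsub>H\<^esub> \<phi> \<one>\<^bsub>G\<^esub>"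
    using mult aw(3) N(3) S_closed(3) by blast
  then have one: "\<phi> \<one>\<^bsub>G\<^esub> = \<one>\<^bsub>H\<^esub>"
    using \<phi>_closed by (simp add: H.l_cancel_one')
  obtain p' where p': "p' \<in> carrier G \<rightarrow>\<^sub>E A" "\<And>x. x \<in> carrier G \<Longrightarrow> x \<notin> N \<Longrightarrow> p' x = pull h c x"
      "T p' = (T (pull h c))(\<one>\<^bsub>G\<^esub> := a)"
    using site[OF pull_closed[OF h c] a] by blast
  let ?h = "\<lambda>x. h \<otimes>\<^bsub>H\<^esub> \<phi> x"
  have inj_h: "inj_on ?h (window G S N)"
    using inj h aw(5) \<phi>_closed by (auto simp: inj_on_def subset_iff)
  define c' where "c' = (\<lambda>y\<in>carrier H. if y \<in> ?h ` N then p' (inv_into N ?h y) else c y)"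
  have NW: "N \<subseteq> window G S N" using aw(3,6) by blast
  have c'N: "c' (?h x) = p' x" if "x \<in> N" for x
    using that N(2) h \<phi>_closed inv_into_f_f[OF inj_on_subset[OF inj_h NW] that]
    by (auto simp: c'_def subset_iff)
  have c'off: "c' y = c y" if "y \<in> carrier H" "y \<notin> ?h ` N" for y
    using that by (simp add: c'_def)
  have c': "c' \<in> carrier H \<rightarrow>\<^sub>E A"
  proof (rule PiE_I)
    fix y assume y: "y \<in> carrier H"
    show "c' y \<in> A"
    proof (cases "y \<in> ?h ` N")
      case True
      then show ?thesis using c'N p'(1) N(2) by auto
    next
      case False
      then show ?thesis using c'off y c by auto
    qed
  qed (simp add: c'_def)
  \<comment> \<open>For \<open>x \<notin> N\<close>, injectivity on the whole window keeps \<open>h \<otimes> \<phi> x\<close> away from the modified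
    sites.\<close>
  have pull': "pull h c' x = p' x" if x: "x \<in> window G S N" for x
  proof -
    have xG: "x \<in> carrier G" using x aw(5) by blast
    show ?thesis
    proof (cases "x \<in> N")
      case True
      then show ?thesis using xG c'N by (simp add: pull_def)
    next
      case False
      then have "?h x \<notin> ?h ` N" using inj_on_image_mem_iff[OF inj_h x NW] by simp
      then show ?thesis using c'off p'(2)[OF xG False] xG h \<phi>_closed by (simp add: pull_def)
    qed
  qed
  have "transplant c' k = ((transplant c)(h := a)) k" if k: "k \<in> carrier H" for k
  proof (cases "k \<in> ?h ` affected G S N")
    case True
    then obtain g where g: "g \<in> affected G S N" "k = ?h g" by blast
    have gG: "g \<in> carrier G" using g aw by blast
    have gs: "g \<otimes>\<^bsub>G\<^esub> s \<in> window G S N" if "s \<in> S" for s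
      using g(1) that by (auto simp: window_def)
    have "transplant c' k = T (pull h c') g"
      unfolding g(2) using transplant_at[OF c' h gG mult[OF g(1)]] .
    also have "\<dots> = T p' g"
      using pull' gs by (intro T_local pull_closed h c' p' gG) blast
    finally have 1: "transplant c' k = ((T (pull h c))(\<one>\<^bsub>G\<^esub> := a)) g" using p'(3) by simp
    have "g = \<one>\<^bsub>G\<^esub> \<longleftrightarrow> k = h"
    proof
      assume "k = h"
      then have "?h g = ?h \<one>\<^bsub>G\<^esub>" using g(2) one h by simp
      then show "g = \<one>\<^bsub>G\<^esub>"
        using inj_onD[OF inj_h] g(1) aw(6) NW N(3) by blast
    qed (use g one h in simp)
    moreover have "transplant c k = T (pull h c) g"
      unfolding g(2) using transplant_at[OF c h gG mult[OF g(1)]] .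
    ultimately show ?thesis using 1 by simp
  next
    case False
    have "transplant c' k = transplant c k"
      by (rule transplant_unaffected[OF N(2) E(1) _ E(3) c' c h k _ False])
        (use aw(6) E(2) c'off in blast)+
    moreover have "k \<noteq> h"
    proof
      assume "k = h"
      then have "k = ?h \<one>\<^bsub>G\<^esub>" using one h by simp
      then show False using False aw(3) N(3) by blast
    qed
    ultimately show ?thesis by simp
  qed
  then have "transplant c' = (transplant c)(h := a)"
    using transplant_closed[OF c'] transplant_closed[OF c] a h
    by (intro PiE_ext[of _ "carrier H" "\<lambda>_. A"]) (auto simp: PiE_iff extensional_def)
  moreover have "asymptotic H c' c"
    unfolding asymptotic_def by (rule finite_subset[of _ "?h ` N"]) (use c'off N(1) in auto)
  ultimately show "\<exists>c'\<in>carrier H \<rightarrow>\<^sub>E A. asymptotic H c' c \<and> transplant c' = (transplant c)(h := a)"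
    using c' by blast
qed

text \<open>
  The window of the finite set \<open>D\<close> of differences is copied to \<open>H\<close> with its two patterns. The
  copies differ only on \<open>\<phi> ` D\<close> and have the same image.
\<close>
lemma pre_injective_transplant_imp:
  assumes pre: "pre_injective H A transplant"
    and c: "c \<in> carrier G \<rightarrow>\<^sub>E A" and d: "d \<in> carrier G \<rightarrow>\<^sub>E A" and eq: "T c = T d"
    and D: "finite D" "D \<subseteq> carrier G" "\<And>x. x \<in> carrier G \<Longrightarrow> c x \<noteq> d x \<Longrightarrow> x \<in> D"
    and E: "local_embedding G H \<phi> E" "window G S D \<subseteq> E" "S \<subseteq> E"
  shows "c = d"
proof -
  note aw = affected_window[OF G.group_axioms S_closed D(1,2)]
  let ?W = "window G S D"
  have inj: "inj_on \<phi> ?W" using E inj_on_subset unfolding local_embedding_def by blast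
  have mult: "\<phi> (g \<otimes>\<^bsub>G\<^esub> s) = \<phi> g \<otimes>\<^bsub>H\<^esub> \<phi> s" if "g \<in> affected G S D" "s \<in> S" for g s
    using that E aw(6) unfolding local_embedding_def by blast
  \<comment> \<open>Outside the copied window both configurations get the same arbitrary letter, here \<open>c \<one>\<close>, so
    that no further difference arises.\<close>
  define push where
    "push f = (\<lambda>y\<in>carrier H. if y \<in> \<phi> ` ?W then f (inv_into ?W \<phi> y) else c \<one>\<^bsub>G\<^esub>)" for f :: "'g \<Rightarrow> 'b"
  have push: "push f \<in> carrier H \<rightarrow>\<^sub>E A" if "f \<in> carrier G \<rightarrow>\<^sub>E A" for f
  proof -
    have "inv_into ?W \<phi> y \<in> carrier G" if "y \<in> \<phi> ` ?W" for y
      using inv_into_into[OF that] aw(5) by blast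
    then show ?thesis using PiE_mem[OF that] PiE_mem[OF c G.one_closed] by (auto simp: push_def)
  qed
  have push_at: "push f (\<phi> x) = f x" if "x \<in> ?W" for f x
    using that inj aw(5) \<phi>_closed by (auto simp: push_def subset_iff)
  have diff: "y \<in> (\<lambda>x. \<one>\<^bsub>H\<^esub> \<otimes>\<^bsub>H\<^esub> \<phi> x) ` D" if "y \<in> carrier H" "push c y \<noteq> push d y" for y
  proof -
    have y: "y \<in> \<phi> ` ?W" using that by (auto simp: push_def split: if_splits)
    then obtain x where x: "x \<in> ?W" "y = \<phi> x" by blast
    then have "x \<in> D" using that(2) push_at D(3) aw(5) by auto
    then show ?thesis using x(2) that(1) by (intro image_eqI[of _ _ x]) auto
  qed
  have "transplant (push c) k = transplant (push d) k" if k: "k \<in> carrier H" for k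
  proof (cases "k \<in> (\<lambda>g. \<one>\<^bsub>H\<^esub> \<otimes>\<^bsub>H\<^esub> \<phi> g) ` affected G S D")
    case True
    then obtain g where g: "g \<in> affected G S D" "k = \<one>\<^bsub>H\<^esub> \<otimes>\<^bsub>H\<^esub> \<phi> g" by blast
    have gG: "g \<in> carrier G" using g aw by blast
    have gs: "g \<otimes>\<^bsub>G\<^esub> s \<in> ?W" if "s \<in> S" for s
      using g(1) that by (auto simp: window_def)
    have "transplant (push f) k = T f g" if f: "f \<in> carrier G \<rightarrow>\<^sub>E A" for f
    proof -
      have "transplant (push f) k = T (pull \<one>\<^bsub>H\<^esub> (push f)) g"
        unfolding g(2) using transplant_at[OF push[OF f] H.one_closed gG mult[OF g(1)]] .
      also have "\<dots> = T f g"
      proof (rule T_local[OF pull_closed[OF H.one_closed push[OF f]] f gG])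
        fix s assume "s \<in> S"
        then have "g \<otimes>\<^bsub>G\<^esub> s \<in> ?W" "g \<otimes>\<^bsub>G\<^esub> s \<in> carrier G" using gs aw(5) by auto
        then show "pull \<one>\<^bsub>H\<^esub> (push f) (g \<otimes>\<^bsub>G\<^esub> s) = f (g \<otimes>\<^bsub>G\<^esub> s)"
          using push_at \<phi>_closed by (simp add: pull_def)
      qed
      finally show ?thesis .
    qed
    then show ?thesis using c d eq by simp
  next
    case False
    show ?thesis
      by (rule transplant_unaffected[OF D(2) E(1) _ E(3) push[OF c] push[OF d] H.one_closed k diff False])
        (use aw(6) E(2) in auto)
  qed
  then have "transplant (push c) = transplant (push d)"
    using transplant_closed push c d by (intro PiE_ext[of _ "carrier H" "\<lambda>_. A"]) auto
  moreover have "asymptotic H (push c) (push d)"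
    unfolding asymptotic_def
    by (rule finite_subset[of _ "(\<lambda>x. \<one>\<^bsub>H\<^esub> \<otimes>\<^bsub>H\<^esub> \<phi> x) ` D"]) (use diff D(1) in auto)
  ultimately have "push c = push d"
    using pre push c d unfolding pre_injective_def by blast
  then have "c x = d x" if "x \<in> D" for x
    using push_at that aw(3,6) by (metis subsetD)
  then show "c = d" using D(3) by (intro PiE_ext[OF c d]) blast
qed

end

section \<open>Groups that embed locally into dual surjunctive groups\<close>

text \<open>
  One and the same group \<open>H\<close> has to serve for both halves of the argument, so the local embedding is
  chosen only after the two configurations to be compared are known: it must respect the window of
  \<open>N\<close> and the window of their differences.
\<close>
theorem dual_surjunctive_if_locally_embeddable:
  fixes G :: "('g, 'm) monoid_scheme"
  assumes G: "group G"
    and emb: "\<And>E. finite E \<Longrightarrow> E \<subseteq> carrier G \<Longrightarrow>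
      \<exists>(H :: ('h, 'n) monoid_scheme) \<phi>. dual_surjunctive H \<and> local_embedding G H \<phi> E"
  shows "dual_surjunctive G"
  unfolding dual_surjunctive_def
proof (intro conjI allI impI)
  fix A :: "nat set" and T
  assume A: "finite A" and T: "cellular_automaton G A T" and post: "post_surjective G A T"
  obtain S where S: "memory_set G A T S" using memory_set_exists[OF G A T] by blast
  then have S': "finite S" "S \<subseteq> carrier G" "\<one>\<^bsub>G\<^esub> \<in> S" by (auto simp: memory_set_def)
  obtain N where N: "finite N" "N \<subseteq> carrier G" "\<one>\<^bsub>G\<^esub> \<in> N"
    and site: "\<forall>p\<in>carrier G \<rightarrow>\<^sub>E A. \<forall>a\<in>A. \<exists>p'\<in>carrier G \<rightarrow>\<^sub>E A.
       (\<forall>x\<in>carrier G - N. p' x = p x) \<and> T p' = (T p)(\<one>\<^bsub>G\<^esub> := a)"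
    using post_surjective_uniform[OF G A T post S] by blast
  show "pre_injective G A T"
    unfolding pre_injective_def
  proof (intro ballI impI)
    fix c d assume c: "c \<in> carrier G \<rightarrow>\<^sub>E A" and d: "d \<in> carrier G \<rightarrow>\<^sub>E A"
      and "asymptotic G c d" and eq: "T c = T d"
    define D where "D = {x \<in> carrier G. c x \<noteq> d x}"
    have D: "finite D" "D \<subseteq> carrier G"
      using \<open>asymptotic G c d\<close> by (auto simp: D_def asymptotic_def)
    let ?E = "window G S N \<union> window G S D \<union> S"
    note awN = affected_window[OF G S' N(1,2)] and awD = affected_window[OF G S' D]
    obtain H :: "('h, 'n) monoid_scheme" and \<phi>
      where H: "dual_surjunctive H" and \<phi>: "local_embedding G H \<phi> ?E"
      using emb[of ?E] awN awD S' by auto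
    interpret tr: transplantation G H A T S \<phi>
      using G H T S \<phi> by (simp add: transplantation_def transplantation_axioms_def
        dual_surjunctive_def local_embedding_def)
    have "post_surjective H A tr.transplant"
      by (rule tr.post_surjective_transplant[OF N _ \<phi>]) (use site in auto)
    then have "pre_injective H A tr.transplant"
      using H A tr.cellular_automaton_transplant unfolding dual_surjunctive_def by blast
    then show "c = d"
      by (rule tr.pre_injective_transplant_imp[OF _ c d eq D _ \<phi>]) (auto simp: D_def)
  qed
qed (rule G)

text \<open>
  Each product relation and each inequality between elements of \<open>E\<close> holds for the representatives at
  almost all coordinates, the inequalities because \<open>U\<close> is an ultrafilter; these are
  finitely many conditions.
\<close>
lemma local_embedding_ultraproduct:
  fixes G :: "'i \<Rightarrow> ('g, 'm) monoid_scheme"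
  assumes G: "\<And>i. group (G i)" and U: "ultrafilter U"
    and E: "finite E" "E \<subseteq> carrier (ultraproduct U G)"
  shows "\<exists>i \<phi>. local_embedding (ultraproduct U G) (G i) \<phi> E"
proof -
  let ?P = "product_group UNIV G" and ?R = "ultraproduct_rel U G" and ?H = "ultraproduct U G"
  interpret P: group ?P by (simp add: G)
  interpret H: group ?H by (rule group_ultraproduct[OF G])
  have car: "carrier ?H = carrier ?P // ?R" by (simp add: ultraproduct_def)
  define rep where "rep X = (SOME x. x \<in> X)" for X :: "('i \<Rightarrow> 'g) set"
  have rep: "rep X \<in> carrier ?P" "?R `` {rep X} = X" if X: "X \<in> carrier ?H" for X
  proof -
    obtain x where x: "x \<in> carrier ?P" "X = ?R `` {x}"
      using X unfolding car by (rule quotientE)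
    have "x \<in> X"
      unfolding x(2) by (rule equiv_class_self[OF equiv_ultraproduct_rel x(1)])
    then have "rep X \<in> X" unfolding rep_def by (rule someI[of "\<lambda>x. x \<in> X"])
    then have xr: "(x, rep X) \<in> ?R" using x(2) by simp
    then show "rep X \<in> carrier ?P" unfolding ultraproduct_rel_def by blast
    show "?R `` {rep X} = X"
      using equiv_class_eq[OF equiv_ultraproduct_rel xr] x(2) by simp
  qed
  have rel: "eventually (\<lambda>i. x i = y i) U"
    if "x \<in> carrier ?P" "y \<in> carrier ?P" "?R `` {x} = ?R `` {y}" for x y
    using eq_equiv_class[OF that(3) equiv_ultraproduct_rel that(2)]
    by (simp add: ultraproduct_rel_def)
  have mult: "eventually (\<lambda>i. rep (X \<otimes>\<^bsub>?H\<^esub> Y) i = rep X i \<otimes>\<^bsub>G i\<^esub> rep Y i) U"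
    if XY: "X \<in> carrier ?H" "Y \<in> carrier ?H" for X Y
  proof -
    note cl = H.m_closed[OF XY]
    have "?R `` {rep (X \<otimes>\<^bsub>?H\<^esub> Y)} = X \<otimes>\<^bsub>?H\<^esub> Y" by (rule rep(2)[OF cl])
    also have "\<dots> = ?R `` {rep X \<otimes>\<^bsub>?P\<^esub> rep Y}"
      using ultraproduct_mult_class[OF G rep(1)[OF XY(1)] rep(1)[OF XY(2)], where U = U]
      unfolding rep(2)[OF XY(1)] rep(2)[OF XY(2)] .
    finally have "eventually (\<lambda>i. rep (X \<otimes>\<^bsub>?H\<^esub> Y) i = (rep X \<otimes>\<^bsub>?P\<^esub> rep Y) i) U"
      by (rule rel[OF rep(1)[OF cl] P.m_closed[OF rep(1)[OF XY(1)] rep(1)[OF XY(2)]]])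
    then show ?thesis by simp
  qed
  have sep: "eventually (\<lambda>i. rep X i = rep Y i \<longrightarrow> X = Y) U"
    if XY: "X \<in> carrier ?H" "Y \<in> carrier ?H" for X Y
  proof (cases "X = Y")
    case False
    have "\<not> eventually (\<lambda>i. rep X i = rep Y i) U"
    proof
      assume "eventually (\<lambda>i. rep X i = rep Y i) U"
      then have "(rep X, rep Y) \<in> ?R"
        using rep(1)[OF XY(1)] rep(1)[OF XY(2)] unfolding ultraproduct_rel_def by blast
      from equiv_class_eq[OF equiv_ultraproduct_rel this] show False
        using False unfolding rep(2)[OF XY(1)] rep(2)[OF XY(2)] by blast
    qed
    then have "eventually (\<lambda>i. rep X i \<noteq> rep Y i) U"
      using U by (auto simp: ultrafilter_def)
    then show ?thesis by (rule eventually_mono) simp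
  qed simp
  have ev: "eventually (\<lambda>i. \<forall>X\<in>E. \<forall>Y\<in>E.
      rep (X \<otimes>\<^bsub>?H\<^esub> Y) i = rep X i \<otimes>\<^bsub>G i\<^esub> rep Y i \<and> (rep X i = rep Y i \<longrightarrow> X = Y)) U"
    using E(2) by (intro eventually_ball_finite[OF E(1)] ballI eventually_conj mult sep) auto
  have "U \<noteq> bot" using U by (simp add: ultrafilter_def)
  then obtain i where i: "\<forall>X\<in>E. \<forall>Y\<in>E.
      rep (X \<otimes>\<^bsub>?H\<^esub> Y) i = rep X i \<otimes>\<^bsub>G i\<^esub> rep Y i \<and> (rep X i = rep Y i \<longrightarrow> X = Y)"
    using eventually_happens'[OF _ ev] by blast
  have "rep X i \<in> carrier (G i)" if "X \<in> carrier ?H" for X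
    using rep(1)[OF that] by (auto simp: PiE_iff)
  then have "local_embedding ?H (G i) (\<lambda>X. rep X i) E"
    using i E(2) by (auto simp: local_embedding_def inj_on_def)
  then show ?thesis by blast
qed

theorem theorem3p5:
  fixes G :: "nat \<Rightarrow> ('g, 'm) monoid_scheme" and U :: "nat filter"
  assumes "\<And>n. dual_surjunctive (G n)"
    and "ultrafilter U"
  shows "dual_surjunctive (ultraproduct U G)"
proof (rule dual_surjunctive_if_locally_embeddable[where 'h = 'g and 'n = 'm])
  have G: "group (G n)" for n using assms(1) by (simp add: dual_surjunctive_def)
  show "group (ultraproduct U G)" by (rule group_ultraproduct[OF G])
  fix E assume E: "finite E" "E \<subseteq> carrier (ultraproduct U G)"
  obtain n \<phi> where "local_embedding (ultraproduct U G) (G n) \<phi> E"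
    using local_embedding_ultraproduct[OF G assms(2) E] by (elim exE)
  with assms(1)[of n] show "\<exists>(H :: ('g, 'm) monoid_scheme) \<phi>. dual_surjunctive H \<and>
      local_embedding (ultraproduct U G) H \<phi> E"
    by (intro exI conjI)
qed

end
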